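(* Let $G$ be a graph without isolated vertices. Then (i) $|\gamma_{Zg}(G)-\gamma_{Zg}'(G)|\le 1$; (ii) $|\gamma_{LLg}(G)-\gamma_{LLg}'(G)|\le 1$; and (iii) $|\gamma_{Lg}(G)-\gamma_{Lg}'(G)|\le 1$.
   Context: All graphs are finite and simple. For a vertex $v$ of a graph $G$, $N(v)$ is its open neighborhood and $N[v]=N(v)\cup\{v\}$ its closed neighborhood. Two players, Dominator and Staller, alternately select a vertex of $G$. In the $i$-th move, after the moves $v_1,\dots,v_{i-1}$, the choice of a vertex $v_i$ is legal if - in the Z-domination game: $N(v_i)\setminus\bigcup_{j=1}^{i-1}N[v_j]\neq\emptyset$; - in the LL-domination game: $N[v_i]\setminus\bigcup_{j=1}^{i-1}N(v_j)\neq\emptyset$; - in the L-domination game: $N[v_i]\setminus\bigcup_{j=1}^{i-1}N(v_j)\neq\emptyset$ and $v_i\neq v_j$ for all $j<i$. The game ends when no legal move is available; its length is the total number of moves played (an unending play, possible in the LL-game since vertices may be repeated there, has infinite length). Dominator wants to minimize the length, Staller wants to maximize it. In a D-game Dominator moves first; in an S-game Staller moves first. The numbers $\gamma_{Zg}(G)$, $\gamma_{Lg}(G)$, $\gamma_{LLg}(G)$ are the lengths, under optimal play by both players, of the D-game on $G$ for the Z-, L-, and LL-domination game, respectively; $\gamma_{Zg}'(G)$, $\gamma_{Lg}'(G)$, $\gamma_{LLg}'(G)$ are the analogous numbers for the S-game. *)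

theory Defs
  imports "Graph_Theory.Pair_Digraph" "HOL-Library.Extended_Nat"
begin

(* Finite simple graphs are the symmetric loop-free finite digraphs without parallel arcs
   (locale pair_graph): an edge {u,v} is the pair of arcs (u,v), (v,u). *)

definition open_nbhd :: "'a pair_pre_digraph \<Rightarrow> 'a \<Rightarrow> 'a set" where
  "open_nbhd G v = {u. (v, u) \<in> parcs G}"

definition closed_nbhd :: "'a pair_pre_digraph \<Rightarrow> 'a \<Rightarrow> 'a set" where
  "closed_nbhd G v = insert v (open_nbhd G v)"

definition no_isolated_vertices :: "'a pair_pre_digraph \<Rightarrow> bool" where
  "no_isolated_vertices G \<longleftrightarrow> (\<forall>v \<in> pverts G. open_nbhd G v \<noteq> {})"


(* A game is given by its legality predicate: "legal h v" says that v may be selected after the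
   moves listed in h, in chronological order. *)

definition Z_legal :: "'a pair_pre_digraph \<Rightarrow> 'a list \<Rightarrow> 'a \<Rightarrow> bool" where
  "Z_legal G h v \<longleftrightarrow> v \<in> pverts G \<and> open_nbhd G v - (\<Union>u\<in>set h. closed_nbhd G u) \<noteq> {}"

definition LL_legal :: "'a pair_pre_digraph \<Rightarrow> 'a list \<Rightarrow> 'a \<Rightarrow> bool" where
  "LL_legal G h v \<longleftrightarrow> v \<in> pverts G \<and> closed_nbhd G v - (\<Union>u\<in>set h. open_nbhd G u) \<noteq> {}"

definition L_legal :: "'a pair_pre_digraph \<Rightarrow> 'a list \<Rightarrow> 'a \<Rightarrow> bool" where
  "L_legal G h v \<longleftrightarrow> v \<in> pverts G \<and> closed_nbhd G v - (\<Union>u\<in>set h. open_nbhd G u) \<noteq> {} \<and> v \<notin> set h"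


datatype player = Dominator | Staller

fun opponent :: "player \<Rightarrow> player" where
  "opponent Dominator = Staller"
| "opponent Staller = Dominator"

definition to_move :: "player \<Rightarrow> nat \<Rightarrow> player" where
  "to_move first n = (if even n then first else opponent first)"

(* A strategy answers every history, and the answer is legal whenever some legal move exists;
   its values where the game is over are irrelevant. *)
definition strategies :: "('a list \<Rightarrow> 'a \<Rightarrow> bool) \<Rightarrow> ('a list \<Rightarrow> 'a) set" where
  "strategies legal = {s. \<forall>h. (\<exists>v. legal h v) \<longrightarrow> legal h (s h)}"

(* The first n moves when Dominator follows d and Staller follows s, where the sequence is
   formally continued after the end of the game. *)
primrec play :: "player \<Rightarrow> ('a list \<Rightarrow> 'a) \<Rightarrow> ('a list \<Rightarrow> 'a) \<Rightarrow> nat \<Rightarrow> 'a list" where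
  "play first d s 0 = []"
| "play first d s (Suc n) =
     (let h = play first d s n
      in h @ [case to_move first n of Dominator \<Rightarrow> d h | Staller \<Rightarrow> s h])"

(* The first time at which no legal move is available; Inf {} = \<infinity> covers unending plays. *)
definition play_length ::
    "('a list \<Rightarrow> 'a \<Rightarrow> bool) \<Rightarrow> player \<Rightarrow> ('a list \<Rightarrow> 'a) \<Rightarrow> ('a list \<Rightarrow> 'a) \<Rightarrow> enat" where
  "play_length legal first d s = Inf {enat n | n. \<not> (\<exists>v. legal (play first d s n) v)}"

(* The length under optimal play. The order of INF and SUP does not matter: if Dominator cannot
   force the end within k moves, then Staller has a strategy lasting more than k moves. *)
definition game_length :: "('a list \<Rightarrow> 'a \<Rightarrow> bool) \<Rightarrow> player \<Rightarrow> enat" where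
  "game_length legal first =
     (INF d \<in> strategies legal. SUP s \<in> strategies legal. play_length legal first d s)"


definition gamma_Zg :: "'a pair_pre_digraph \<Rightarrow> enat" where
  "gamma_Zg G = game_length (Z_legal G) Dominator"

definition gamma_Zg' :: "'a pair_pre_digraph \<Rightarrow> enat" where
  "gamma_Zg' G = game_length (Z_legal G) Staller"

definition gamma_Lg :: "'a pair_pre_digraph \<Rightarrow> enat" where
  "gamma_Lg G = game_length (L_legal G) Dominator"

definition gamma_Lg' :: "'a pair_pre_digraph \<Rightarrow> enat" where
  "gamma_Lg' G = game_length (L_legal G) Staller"

definition gamma_LLg :: "'a pair_pre_digraph \<Rightarrow> enat" where
  "gamma_LLg G = game_length (LL_legal G) Dominator"

definition gamma_LLg' :: "'a pair_pre_digraph \<Rightarrow> enat" where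
  "gamma_LLg' G = game_length (LL_legal G) Staller"

end

(* Everything follows from a continuation principle in the style of the imagination strategy:
   if every vertex covered after the history b is also covered after the history a, then the
   remaining game after a is not longer than after b. Dominator plays the real game after a and
   imagines an optimal one after b; moves of Staller are copied into the imagined game, and an
   optimal imagined answer that is illegal in the real game covers (almost) nothing new there and
   is replaced by some legal move. In the Z-game the exception is the played vertex v itself,
   which Dominator covers by playing a neighbour of v. In the L-game one has to compare the sets
   of played vertices as well. As one move played before the game starts only helps Dominator,
   the two lengths differ by at most 1. They are finite because Dominator can cover a new vertex
   in each of his moves. *)

theory Submission
  imports Defs
begin

section \<open>Optimal play by backward induction\<close>

text \<open>Dominator can force the end within \<open>k\<close> further moves when \<open>p\<close>
  moves next after \<open>h\<close>. Being free of strategies, this notion lets games after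
  different histories be compared.\<close>

primrec ends_within :: "('a list \<Rightarrow> 'a \<Rightarrow> bool) \<Rightarrow> nat \<Rightarrow> player \<Rightarrow> 'a list \<Rightarrow> bool" where
  "ends_within legal 0 p h \<longleftrightarrow> \<not> (\<exists>v. legal h v)"
| "ends_within legal (Suc k) p h \<longleftrightarrow> \<not> (\<exists>v. legal h v) \<or>
     (case p of
        Dominator \<Rightarrow> \<exists>v. legal h v \<and> ends_within legal k Staller (h @ [v])
      | Staller \<Rightarrow> \<forall>v. legal h v \<longrightarrow> ends_within legal k Dominator (h @ [v]))"

lemma ends_within_over: "\<not> (\<exists>v. legal h v) \<Longrightarrow> ends_within legal k p h"
  by (cases k) auto

lemma length_play [simp]: "length (play first d s n) = n"
  by (induction n) (auto simp: Let_def)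

lemma to_move_Suc: "to_move first (Suc n) = opponent (to_move first n)"
  by (cases first) (auto simp: to_move_def)

lemma to_move_0: "to_move first 0 = first"
  by (simp add: to_move_def)

lemma strategy_preferring:
  obtains s where "s \<in> strategies legal"
    and "\<And>h v. legal h v \<Longrightarrow> P h v \<Longrightarrow> P h (s h)"
proof
  define s where "s h = (if \<exists>v. legal h v \<and> P h v then SOME v. legal h v \<and> P h v
                          else SOME v. legal h v)" for h
  have preferred: "legal h (s h) \<and> P h (s h)" if "\<exists>v. legal h v \<and> P h v" for h
    using someI_ex[OF that] that by (simp add: s_def)
  have "legal h (s h)" if "\<exists>v. legal h v" for h
    using preferred[of h] someI_ex[OF that] by (cases "\<exists>v. legal h v \<and> P h v") (auto simp: s_def)
  then show "s \<in> strategies legal"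
    by (auto simp: strategies_def)
  show "P h (s h)" if "legal h v" "P h v" for h v
    using preferred that by blast
qed

text \<open>Dominator always moves to a position that still ends within the remaining budget. A
  strategy sees only the history, so the budget is computed from its length.\<close>

lemma game_length_le:
  assumes "ends_within legal k first []"
  shows "game_length legal first \<le> enat k"
proof -
  obtain d where d: "d \<in> strategies legal"
    and best: "\<And>h v. legal h v \<Longrightarrow> ends_within legal (k - Suc (length h)) Staller (h @ [v])
                 \<Longrightarrow> ends_within legal (k - Suc (length h)) Staller (h @ [d h])"
    using strategy_preferring[of legal "\<lambda>h v. ends_within legal (k - Suc (length h)) Staller (h @ [v])"]
    by metis
  have "play_length legal first d s \<le> enat k" if s: "s \<in> strategies legal" for s
  proof -
    have "\<exists>n\<le>k. \<not> (\<exists>v. legal (play first d s n) v)"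
    proof (rule ccontr)
      assume "\<not> ?thesis"
      then have running: "\<exists>v. legal (play first d s n) v" if "n \<le> k" for n
        using that by blast
      have "ends_within legal (k - n) (to_move first n) (play first d s n)" if "n \<le> k" for n
        using that
      proof (induction n)
        case 0
        then show ?case using assms by (simp add: to_move_0)
      next
        case (Suc n)
        let ?h = "play first d s n"
        have k: "k - n = Suc (k - Suc n)" using Suc.prems by simp
        have IH: "ends_within legal (Suc (k - Suc n)) (to_move first n) ?h"
          using Suc k by simp
        have ex: "\<exists>v. legal ?h v" using running Suc.prems by simp
        show ?case
        proof (cases "to_move first n")
          case Dominator
          then show ?thesis using IH ex best[of ?h]
            by (auto simp: Let_def to_move_Suc)
        next
          case Staller
          moreover have "legal ?h (s ?h)" using s ex by (auto simp: strategies_def)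
          ultimately show ?thesis using IH ex by (auto simp: Let_def to_move_Suc)
        qed
      qed
      \<comment> \<open>At \<open>n = k\<close> the budget is \<open>0\<close>, so no legal move is
        left.\<close>
      from this[of k] running[of k] show False by simp
    qed
    then obtain n where "n \<le> k" "\<not> (\<exists>v. legal (play first d s n) v)" by blast
    then have "play_length legal first d s \<le> enat n"
      unfolding play_length_def by (intro Inf_lower) auto
    then show ?thesis using \<open>n \<le> k\<close> by (meson enat_ord_simps(1) order_trans)
  qed
  then show ?thesis
    unfolding game_length_def using d by (meson INF_lower2 SUP_least)
qed

text \<open>By contraposition: Staller always keeps the end out of reach of the remaining budget.
  One such \<open>s\<close> serves against every \<open>d\<close>, so it bounds the
  \<open>SUP\<close> from below for each \<open>d\<close>.\<close>

lemma ends_within_if_game_length_le: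
  assumes "game_length legal first \<le> enat k"
  shows "ends_within legal k first []"
proof (rule ccontr)
  assume neg: "\<not> ends_within legal k first []"
  obtain s where s: "s \<in> strategies legal"
    and best: "\<And>h v. legal h v \<Longrightarrow> \<not> ends_within legal (k - Suc (length h)) Dominator (h @ [v])
                 \<Longrightarrow> \<not> ends_within legal (k - Suc (length h)) Dominator (h @ [s h])"
    using strategy_preferring[of legal "\<lambda>h v. \<not> ends_within legal (k - Suc (length h)) Dominator (h @ [v])"]
    by metis
  have "enat (Suc k) \<le> play_length legal first d s" if d: "d \<in> strategies legal" for d
  proof -
    have running: "\<exists>v. legal (play first d s n) v"
      if "\<not> ends_within legal (k - n) (to_move first n) (play first d s n)" for n
      using that ends_within_over by blast
    have "\<not> ends_within legal (k - n) (to_move first n) (play first d s n)" if "n \<le> k" for n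
      using that
    proof (induction n)
      case 0
      then show ?case using neg by (simp add: to_move_0)
    next
      case (Suc n)
      let ?h = "play first d s n"
      have k: "k - n = Suc (k - Suc n)" using Suc.prems by simp
      have IH: "\<not> ends_within legal (Suc (k - Suc n)) (to_move first n) ?h"
        using Suc k by simp
      show ?case
      proof (cases "to_move first n")
        case Dominator
        moreover have "legal ?h (d ?h)"
          using d running[of n] Suc by (auto simp: strategies_def)
        ultimately show ?thesis using IH by (auto simp: Let_def to_move_Suc)
      next
        case Staller
        then show ?thesis using IH best[of ?h] by (auto simp: Let_def to_move_Suc)
      qed
    qed
    \<comment> \<open>The game is still running at \<open>n = k\<close> itself, which gives the
      extra move.\<close>
    then have "Suc k \<le> n" if "\<not> (\<exists>v. legal (play first d s n) v)" for n
      using running that not_less_eq_eq by blast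
    then show ?thesis
      unfolding play_length_def by (intro Inf_greatest) auto
  qed
  then have "enat (Suc k) \<le> game_length legal first"
    unfolding game_length_def using s by (meson INF_greatest SUP_upper2)
  then show False
    using assms by (metis Suc_n_not_le_n enat_ord_simps(1) order_trans)
qed

section \<open>Abstract continuation principle and its consequences for game lengths\<close>

text \<open>\<open>ahead a b\<close> compares the real history \<open>a\<close> with the imagined
  \<open>b\<close>. In \<open>answer\<close>, \<open>u\<close> only witnesses that the real game is
  not over. \<open>potential\<close> serves to prove finiteness.\<close>

locale continuation_game =
  fixes legal :: "'a list \<Rightarrow> 'a \<Rightarrow> bool"
    and ahead :: "'a list \<Rightarrow> 'a list \<Rightarrow> bool"
    and potential :: "'a list \<Rightarrow> nat"
  assumes copy_move: "ahead a b \<Longrightarrow> legal a v \<Longrightarrow> legal b v \<and> ahead (a @ [v]) (b @ [v])"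
    and answer: "ahead a b \<Longrightarrow> legal b v \<Longrightarrow> legal a u \<Longrightarrow> \<exists>w. legal a w \<and> ahead (a @ [w]) (b @ [v])"
    and ahead_single: "ahead [v] []"
    and potential_le: "potential (h @ [v]) \<le> potential h"
    and potential_less: "legal h v \<Longrightarrow> \<exists>w. legal h w \<and> potential (h @ [w]) < potential h"
begin

lemma continuation_principle:
  "ends_within legal k p b \<Longrightarrow> ahead a b \<Longrightarrow> ends_within legal k p a"
proof (induction k arbitrary: p a b)
  case 0
  then show ?case using copy_move by auto
next
  case (Suc k)
  show ?case
  proof (cases "\<exists>v. legal a v")
    case True
    \<comment> \<open>The imagined game cannot stop before the real one, so only the second disjunct
      of \<open>ends_within\<close> is possible for \<open>b\<close>.\<close>
    then have ex: "\<exists>v. legal b v" using Suc.prems copy_move by blast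
    show ?thesis
    proof (cases p)
      case Dominator
      then obtain v where v: "legal b v" "ends_within legal k Staller (b @ [v])"
        using Suc.prems ex by auto
      then obtain w where w: "legal a w" "ahead (a @ [w]) (b @ [v])"
        using answer Suc.prems True by blast
      with Suc.IH[OF v(2) w(2)] Dominator show ?thesis by auto
    next
      case Staller
      then have "ends_within legal k Dominator (a @ [v])" if "legal a v" for v
        using Suc.prems ex Suc.IH copy_move[of a b v] that by auto
      with Staller show ?thesis by simp
    qed
  qed (rule ends_within_over)
qed

text \<open>Dominator can lower the potential in each of his moves, and no move of Staller raises
  it.\<close>

lemma ends_within_twice_potential: "potential h \<le> n \<Longrightarrow> ends_within legal (2 * n) Dominator h"
proof (induction n arbitrary: h)
  case 0
  then show ?case using potential_less[of h] by auto
next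
  case (Suc n)
  show ?case
  proof (cases "\<exists>v. legal h v")
    case True
    then obtain w where w: "legal h w" "potential (h @ [w]) < potential h"
      using potential_less by blast
    have "ends_within legal (2 * n) Dominator ((h @ [w]) @ [v])" for v
      using potential_le[of "h @ [w]" v] w Suc.prems by (intro Suc.IH) simp
    then have "ends_within legal (Suc (2 * n)) Staller (h @ [w])" by simp
    with w show ?thesis by auto
  qed (rule ends_within_over)
qed

text \<open>Any first move puts the real game ahead of the empty history, so the argument works
  whichever player makes it.\<close>

lemma ends_within_opponent_starts:
  assumes "ends_within legal k p []"
  shows "ends_within legal (Suc k) (opponent p) []"
proof -
  have "ends_within legal k p [v]" for v
    using continuation_principle assms ahead_single by blast
  then show ?thesis by (cases p) auto
qed

lemma game_length_opponent_le:
  "game_length legal p \<le> enat k \<Longrightarrow> game_length legal (opponent p) \<le> enat (Suc k)"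
  using ends_within_if_game_length_le ends_within_opponent_starts game_length_le by blast

theorem game_lengths_differ_by_at_most_1:
  "\<exists>m n. game_length legal Dominator = enat m \<and> game_length legal Staller = enat n
         \<and> \<bar>int m - int n\<bar> \<le> 1"
proof -
  have D_le: "game_length legal Dominator \<le> enat (2 * potential [])"
    using ends_within_twice_potential game_length_le by blast
  then obtain m where m: "game_length legal Dominator = enat m"
    using enat_ile by blast
  \<comment> \<open>Besides giving one of the two inequalities, this carries finiteness from the
    D-game to the S-game.\<close>
  have S_le: "game_length legal Staller \<le> enat (Suc m)"
    using game_length_opponent_le[of Dominator m] m by simp
  then obtain n where n: "game_length legal Staller = enat n"
    using enat_ile by blast
  have "m \<le> Suc n" using game_length_opponent_le[of Staller n] m n by simp
  moreover have "n \<le> Suc m" using S_le n by simp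
  ultimately show ?thesis using m n by auto
qed

end

section \<open>Covering in graphs and the three domination games\<close>

lemma open_nbhd_subset:
  assumes "pair_graph G"
  shows "open_nbhd G v \<subseteq> pverts G"
proof -
  interpret pair_graph G by fact
  show ?thesis using in_arcsD2 by (auto simp: open_nbhd_def)
qed

lemma open_nbhd_sym:
  assumes "pair_graph G" and "u \<in> open_nbhd G v"
  shows "v \<in> open_nbhd G u"
proof -
  interpret pair_graph G by fact
  show ?thesis using assms(2) arcs_symmetric by (auto simp: open_nbhd_def)
qed

lemma obtain_neighbour:
  assumes "pair_graph G" and "no_isolated_vertices G" and "v \<in> pverts G"
  obtains u where "u \<in> pverts G" "v \<in> open_nbhd G u"
  using assms open_nbhd_sym[OF assms(1)] open_nbhd_subset[OF assms(1)]
  unfolding no_isolated_vertices_def by blast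

text \<open>The potential of all three games, with \<open>N\<close> being \<open>closed_nbhd\<close>
  for Z and \<open>open_nbhd\<close> for LL and L.\<close>

definition uncovered :: "'a pair_pre_digraph \<Rightarrow> ('a \<Rightarrow> 'a set) \<Rightarrow> 'a list \<Rightarrow> nat" where
  "uncovered G N h = card (pverts G - (\<Union>u\<in>set h. N u))"

lemma uncovered_le:
  assumes "pair_graph G"
  shows "uncovered G N (h @ [v]) \<le> uncovered G N h"
proof -
  interpret pair_graph G by fact
  show ?thesis unfolding uncovered_def by (intro card_mono) auto
qed

lemma uncovered_less:
  assumes "pair_graph G" and "x \<in> pverts G" "x \<notin> (\<Union>u\<in>set h. N u)" "x \<in> N w"
  shows "uncovered G N (h @ [w]) < uncovered G N h"
proof -
  interpret pair_graph G by fact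
  show ?thesis unfolding uncovered_def using assms(2-) by (intro psubset_card_mono) auto
qed

lemma continuation_game_Z:
  assumes G: "pair_graph G" and iso: "no_isolated_vertices G"
  shows "continuation_game (Z_legal G)
    (\<lambda>a b. (\<Union>u\<in>set b. closed_nbhd G u) \<subseteq> (\<Union>u\<in>set a. closed_nbhd G u))
    (uncovered G (closed_nbhd G))"
    (is "continuation_game ?legal ?ahead ?potential")
proof
  fix a b v assume ahead: "?ahead a b" and v: "?legal a v"
  then have "?legal b v" unfolding Z_legal_def by blast
  moreover have "?ahead (a @ [v]) (b @ [v])" using ahead by auto
  ultimately show "?legal b v \<and> ?ahead (a @ [v]) (b @ [v])" by blast
next
  fix a b u v assume ahead: "?ahead a b" and v: "?legal b v" and u: "?legal a u"
  let ?A = "\<Union>u\<in>set a. closed_nbhd G u"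
  show "\<exists>w. ?legal a w \<and> ?ahead (a @ [w]) (b @ [v])"
  proof (cases "?legal a v")
    case True
    then show ?thesis using ahead by (intro exI[of _ v]) auto
  next
    case False
    then have covered: "open_nbhd G v \<subseteq> ?A"
      using v by (auto simp: Z_legal_def)
    show ?thesis
    proof (cases "v \<in> ?A")
      case True
      then have "closed_nbhd G v \<subseteq> ?A" using covered by (auto simp: closed_nbhd_def)
      then show ?thesis using u ahead by (intro exI[of _ u]) auto
    next
      case False
      obtain w where w: "w \<in> pverts G" "v \<in> open_nbhd G w"
        using obtain_neighbour[OF G iso] v by (auto simp: Z_legal_def)
      \<comment> \<open>The uncovered vertex that makes \<open>w\<close> legal is \<open>v\<close>
        itself.\<close>
      then have "?legal a w" using False by (auto simp: Z_legal_def)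
      moreover have "closed_nbhd G v \<subseteq> ?A \<union> closed_nbhd G w"
        using covered w by (auto simp: closed_nbhd_def)
      ultimately show ?thesis using ahead by (intro exI[of _ w]) auto
    qed
  qed
next
  \<comment> \<open>In the Z-game every legal move already covers a new vertex, since N(v) lies in
    N[v].\<close>
  fix h v assume legal: "?legal h v"
  then obtain x where "x \<in> open_nbhd G v" "x \<notin> (\<Union>u\<in>set h. closed_nbhd G u)"
    by (auto simp: Z_legal_def)
  then have "?potential (h @ [v]) < ?potential h"
    using open_nbhd_subset[OF G] by (intro uncovered_less[OF G, of x]) (auto simp: closed_nbhd_def)
  with legal show "\<exists>w. ?legal h w \<and> ?potential (h @ [w]) < ?potential h" by blast
qed (use uncovered_le[OF G] in auto)

text \<open>A legal \<open>v\<close> may cover nothing new, if only \<open>v\<close> itself is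
  uncovered. Playing a neighbour \<open>w\<close> of an uncovered \<open>x\<close> does cover
  \<open>x\<close>, and \<open>w\<close> was not played before, as otherwise \<open>x\<close> would
  be covered. Thus \<open>w\<close> suits both the LL- and the L-game.\<close>

lemma LL_legal_uncovers:
  assumes G: "pair_graph G" and iso: "no_isolated_vertices G" and "LL_legal G h v"
  obtains w where "L_legal G h w" "LL_legal G h w"
    "uncovered G (open_nbhd G) (h @ [w]) < uncovered G (open_nbhd G) h"
proof -
  have "closed_nbhd G v \<subseteq> pverts G"
    using assms(3) open_nbhd_subset[OF G, of v] by (simp add: LL_legal_def closed_nbhd_def)
  then obtain x where x: "x \<in> pverts G" "x \<notin> (\<Union>u\<in>set h. open_nbhd G u)"
    using assms(3) unfolding LL_legal_def by blast
  obtain w where w: "w \<in> pverts G" "x \<in> open_nbhd G w"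
    using obtain_neighbour[OF G iso x(1)] by blast
  show thesis
  proof
    show "L_legal G h w" "LL_legal G h w"
      using x w by (auto simp: L_legal_def LL_legal_def closed_nbhd_def)
    show "uncovered G (open_nbhd G) (h @ [w]) < uncovered G (open_nbhd G) h"
      using x w by (intro uncovered_less[OF G, of x]) auto
  qed
qed

lemma continuation_game_LL:
  assumes G: "pair_graph G" and iso: "no_isolated_vertices G"
  shows "continuation_game (LL_legal G)
    (\<lambda>a b. (\<Union>u\<in>set b. open_nbhd G u) \<subseteq> (\<Union>u\<in>set a. open_nbhd G u))
    (uncovered G (open_nbhd G))"
    (is "continuation_game ?legal ?ahead ?potential")
proof
  fix a b v assume ahead: "?ahead a b" and v: "?legal a v"
  then have "?legal b v" unfolding LL_legal_def by blast
  moreover have "?ahead (a @ [v]) (b @ [v])" using ahead by auto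
  ultimately show "?legal b v \<and> ?ahead (a @ [v]) (b @ [v])" by blast
next
  fix a b u v assume ahead: "?ahead a b" and v: "?legal b v" and u: "?legal a u"
  show "\<exists>w. ?legal a w \<and> ?ahead (a @ [w]) (b @ [v])"
  proof (cases "?legal a v")
    case True
    then show ?thesis using ahead by (intro exI[of _ v]) auto
  next
    case False
    \<comment> \<open>Illegality means that all of N[v] is covered, so no exceptional case arises
      here.\<close>
    then have "open_nbhd G v \<subseteq> (\<Union>u\<in>set a. open_nbhd G u)"
      using v by (auto simp: LL_legal_def closed_nbhd_def)
    then show ?thesis using u ahead by (intro exI[of _ u]) auto
  qed
next
  fix h v assume "?legal h v"
  then show "\<exists>w. ?legal h w \<and> ?potential (h @ [w]) < ?potential h"
    using LL_legal_uncovers[OF G iso] by blast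
qed (use uncovered_le[OF G] in auto)

text \<open>The second clause of the relation says that vertices spent in the imagined game are
  unplayable in the real one, so copying a move never repeats a vertex. It persists because played
  vertices and coverage only grow.\<close>

lemma continuation_game_L:
  assumes G: "pair_graph G" and iso: "no_isolated_vertices G"
  shows "continuation_game (L_legal G)
    (\<lambda>a b. (\<Union>u\<in>set b. open_nbhd G u) \<subseteq> (\<Union>u\<in>set a. open_nbhd G u) \<and>
           (\<forall>v\<in>set b. v \<in> set a \<or> closed_nbhd G v \<subseteq> (\<Union>u\<in>set a. open_nbhd G u)))
    (uncovered G (open_nbhd G))"
    (is "continuation_game ?legal ?ahead ?potential")
proof
  fix a b v assume ahead: "?ahead a b" and v: "?legal a v"
  have "v \<notin> set b" using ahead v by (metis Diff_eq_empty_iff L_legal_def)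
  then have "?legal b v" using v Diff_mono[OF order_refl conjunct1[OF ahead]]
    unfolding L_legal_def by blast
  moreover have "?ahead (a @ [v]) (b @ [v])" using ahead by auto
  ultimately show "?legal b v \<and> ?ahead (a @ [v]) (b @ [v])" by blast
next
  fix a b u v assume ahead: "?ahead a b" and v: "?legal b v" and u: "?legal a u"
  let ?A = "\<Union>u\<in>set a. open_nbhd G u"
  show "\<exists>w. ?legal a w \<and> ?ahead (a @ [w]) (b @ [v])"
  proof (cases "?legal a v")
    case True
    then show ?thesis using ahead by (intro exI[of _ v]) auto
  next
    case False
    then have dead: "v \<in> set a \<or> closed_nbhd G v \<subseteq> ?A"
      using v by (auto simp: L_legal_def)
    \<comment> \<open>If \<open>v\<close> was played in \<open>a\<close>, its neighbourhood is one
      of those united in \<open>?A\<close>.\<close>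
    then have "open_nbhd G v \<subseteq> ?A" by (auto simp: closed_nbhd_def)
    then show ?thesis using u ahead dead by (intro exI[of _ u]) auto
  qed
next
  fix h v assume "?legal h v"
  then have "LL_legal G h v" by (simp add: L_legal_def LL_legal_def)
  then show "\<exists>w. ?legal h w \<and> ?potential (h @ [w]) < ?potential h"
    using LL_legal_uncovers[OF G iso] by blast
qed (use uncovered_le[OF G] in auto)

theorem theorem2p2:
  fixes G :: "'a pair_pre_digraph"
  assumes "pair_graph G" and "no_isolated_vertices G"
  shows "(\<exists>m n. gamma_Zg G = enat m \<and> gamma_Zg' G = enat n \<and> \<bar>int m - int n\<bar> \<le> 1)
       \<and> (\<exists>m n. gamma_LLg G = enat m \<and> gamma_LLg' G = enat n \<and> \<bar>int m - int n\<bar> \<le> 1)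
       \<and> (\<exists>m n. gamma_Lg G = enat m \<and> gamma_Lg' G = enat n \<and> \<bar>int m - int n\<bar> \<le> 1)"
  unfolding gamma_Zg_def gamma_Zg'_def gamma_LLg_def gamma_LLg'_def gamma_Lg_def gamma_Lg'_def
  using continuation_game_Z[OF assms, THEN continuation_game.game_lengths_differ_by_at_most_1]
    continuation_game_LL[OF assms, THEN continuation_game.game_lengths_differ_by_at_most_1]
    continuation_game_L[OF assms, THEN continuation_game.game_lengths_differ_by_at_most_1]
  by blast

end
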